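(* Let $M$ be a transversal matroid of rank $r$, and let $\mathcal{A}^i$ be a presentation of $M$ that has rank $i$ in the ordered set of presentations of $M$. If $1\le i<r$, then $$|T_{\mathcal{A}^i}|=|L_{\mathcal{A}^i}|\le\Bigl(\frac12+\frac1{2^{i+1}}\Bigr)2^r,$$ and these bounds are sharp (for each such $r$ and $i$ there exist a rank-$r$ transversal matroid and a presentation of rank $i$ attaining equality). If $i\ge r$, then $|T_{\mathcal{A}^i}|=|L_{\mathcal{A}^i}|\le 2^{r-1}$.
   Context: $[r]=\{1,\dots,r\}$. For a set system $\mathcal{A}=(A_i:i\in[r])$ on a finite set $E$, $M[\mathcal{A}]$ is the transversal matroid on $E$ whose independent sets are the partial transversals of $\mathcal{A}$; $\mathcal{A}$ is a presentation of $M[\mathcal{A}]$; presentations of a rank-$r$ matroid have exactly $r$ sets. Presentations of $M$ are ordered by $(A_i)\preceq(B_i)$ iff $A_i\subseteq B_i$ for all $i$; this ordered set is ranked, the rank of a presentation $(A_i:i\in[r])$ being $r(r-1)-\sum_{i=1}^r r(M\backslash A_i)$ (minimal presentations have rank $0$). Fix $x\notin E$; for $I\subseteq[r]$, $\mathcal{A}^I$ is obtained from $\mathcal{A}$ by replacing $A_i$ by $A_i\cup\{x\}$ for each $i\in I$. Let $\sigma_\mathcal{A}(I)=I\cup\{k\in[r]-I: x\text{ is a coloop of } M[\mathcal{A}^I]\backslash A_k\}$; $L_\mathcal{A}$ is the set of $I\subseteq[r]$ with $\sigma_\mathcal{A}(I)=I$. $T_\mathcal{A}=\{M[\mathcal{A}^I]: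 I\subseteq[r]\}$ is the set of distinct transversal single-element extensions of $M$ obtained by extending $\mathcal{A}$.
   Formalization: For r = 0 the bound 2^{r-1} = 1/2 in the case i ≥ r fails (the rank-0 matroid has |T| = |L| = 1); the formal statement reads the bound as 1 when r = 0 and is literal for every r ≥ 1. *)

theory Defs
  imports Complex_Main
begin

text \<open>A matroid is a pair of a ground set and its family of independent sets.\<close>

type_synonym 'a matroid = "'a set \<times> 'a set set"

abbreviation ground :: "'a matroid \<Rightarrow> 'a set" where
  "ground M \<equiv> fst M"

abbreviation indep_sets :: "'a matroid \<Rightarrow> 'a set set" where
  "indep_sets M \<equiv> snd M"

definition is_matroid :: "'a matroid \<Rightarrow> bool" where
  "is_matroid M \<longleftrightarrow>
     finite (ground M) \<and> (\<forall>X\<in>indep_sets M. X \<subseteq> ground M) \<and>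
     {} \<in> indep_sets M \<and>
     (\<forall>X Y. X \<in> indep_sets M \<and> Y \<subseteq> X \<longrightarrow> Y \<in> indep_sets M) \<and>
     (\<forall>X Y. X \<in> indep_sets M \<and> Y \<in> indep_sets M \<and> card X < card Y \<longrightarrow>
        (\<exists>y\<in>Y - X. insert y X \<in> indep_sets M))"

definition basis :: "'a matroid \<Rightarrow> 'a set \<Rightarrow> bool" where
  "basis M B \<longleftrightarrow> B \<in> indep_sets M \<and> (\<forall>C\<in>indep_sets M. B \<subseteq> C \<longrightarrow> C = B)"

definition matroid_rank :: "'a matroid \<Rightarrow> nat" where
  "matroid_rank M = Max (card ` indep_sets M)"

definition deletion :: "'a matroid \<Rightarrow> 'a set \<Rightarrow> 'a matroid" where
  "deletion M X = (ground M - X, {Y \<in> indep_sets M. Y \<inter> X = {}})"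

definition coloop :: "'a matroid \<Rightarrow> 'a \<Rightarrow> bool" where
  "coloop M e \<longleftrightarrow> e \<in> ground M \<and> (\<forall>B. basis M B \<longrightarrow> e \<in> B)"

text \<open>A set system \<open>(A\<^sub>i : i \<in> [s])\<close> is a function \<^typ>\<open>nat \<Rightarrow> 'a set\<close> of which only the values
  on \<open>{1..s}\<close> are relevant.\<close>

definition set_system :: "'a set \<Rightarrow> nat \<Rightarrow> (nat \<Rightarrow> 'a set) \<Rightarrow> bool" where
  "set_system E s A \<longleftrightarrow> finite E \<and> (\<forall>i\<in>{1..s}. A i \<subseteq> E)"

definition partial_transversal :: "nat \<Rightarrow> (nat \<Rightarrow> 'a set) \<Rightarrow> 'a set \<Rightarrow> bool" where
  "partial_transversal s A X \<longleftrightarrow>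
     (\<exists>\<phi>. inj_on \<phi> X \<and> (\<forall>e\<in>X. \<phi> e \<in> {1..s} \<and> e \<in> A (\<phi> e)))"

definition matroid_of :: "'a set \<Rightarrow> nat \<Rightarrow> (nat \<Rightarrow> 'a set) \<Rightarrow> 'a matroid" where
  "matroid_of E s A = (E, {X. X \<subseteq> E \<and> partial_transversal s A X})"

definition transversal_matroid :: "'a matroid \<Rightarrow> bool" where
  "transversal_matroid M \<longleftrightarrow>
     (\<exists>s A. set_system (ground M) s A \<and> M = matroid_of (ground M) s A)"

definition presentation :: "'a matroid \<Rightarrow> (nat \<Rightarrow> 'a set) \<Rightarrow> bool" where
  "presentation M A \<longleftrightarrow>
     set_system (ground M) (matroid_rank M) A \<and> M = matroid_of (ground M) (matroid_rank M) A"

definition pres_le :: "nat \<Rightarrow> (nat \<Rightarrow> 'a set) \<Rightarrow> (nat \<Rightarrow> 'a set) \<Rightarrow> bool" where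
  "pres_le r A B \<longleftrightarrow> (\<forall>i\<in>{1..r}. A i \<subseteq> B i)"

text \<open>That this is the rank function of the set of presentations ordered by \<^const>\<open>pres_le\<close> is
  proved in \<open>presentation_rank_minimal\<close> and \<open>presentation_rank_cover\<close> below.\<close>

definition presentation_rank :: "'a matroid \<Rightarrow> (nat \<Rightarrow> 'a set) \<Rightarrow> int" where
  "presentation_rank M A =
     int (matroid_rank M) * (int (matroid_rank M) - 1)
       - (\<Sum>i=1..matroid_rank M. int (matroid_rank (deletion M (A i))))"

definition extend_system :: "(nat \<Rightarrow> 'a set) \<Rightarrow> 'a \<Rightarrow> nat set \<Rightarrow> nat \<Rightarrow> 'a set" where
  "extend_system A x I = (\<lambda>i. if i \<in> I then A i \<union> {x} else A i)"

definition extension_matroid ::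
    "'a set \<Rightarrow> nat \<Rightarrow> (nat \<Rightarrow> 'a set) \<Rightarrow> 'a \<Rightarrow> nat set \<Rightarrow> 'a matroid" where
  "extension_matroid E r A x I = matroid_of (E \<union> {x}) r (extend_system A x I)"

definition sigma_op :: "'a set \<Rightarrow> nat \<Rightarrow> (nat \<Rightarrow> 'a set) \<Rightarrow> 'a \<Rightarrow> nat set \<Rightarrow> nat set" where
  "sigma_op E r A x I =
     I \<union> {k \<in> {1..r} - I. coloop (deletion (extension_matroid E r A x I) (A k)) x}"

definition L_sets :: "'a set \<Rightarrow> nat \<Rightarrow> (nat \<Rightarrow> 'a set) \<Rightarrow> 'a \<Rightarrow> nat set set" where
  "L_sets E r A x = {I. I \<subseteq> {1..r} \<and> sigma_op E r A x I = I}"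

definition T_exts :: "'a set \<Rightarrow> nat \<Rightarrow> (nat \<Rightarrow> 'a set) \<Rightarrow> 'a \<Rightarrow> 'a matroid set" where
  "T_exts E r A x = {extension_matroid E r A x I | I. I \<subseteq> {1..r}}"


lemma partial_transversal_augment:
  assumes "finite X" "finite Y" "card X < card Y"
    and "partial_transversal s A X" "partial_transversal s A Y"
  shows "\<exists>y\<in>Y - X. partial_transversal s A (insert y X)"
proof -
  obtain \<psi> where \<psi>: "inj_on \<psi> Y" "\<forall>e\<in>Y. \<psi> e \<in> {1..s} \<and> e \<in> A (\<psi> e)"
    using assms(5) unfolding partial_transversal_def by blast
  have "\<exists>y\<in>Y - X. partial_transversal s A (insert y X)"
    if "inj_on \<phi> X" "\<forall>e\<in>X. \<phi> e \<in> {1..s} \<and> e \<in> A (\<phi> e)" for \<phi>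
    using that
  proof (induction "card {e\<in>X \<inter> Y. \<phi> e \<noteq> \<psi> e}" arbitrary: \<phi> rule: less_induct)
    case less
    have "card (\<phi> ` X) < card (\<psi> ` Y)"
      using less.prems(1) \<psi>(1) assms(3) by (simp add: card_image)
    then have "\<not> \<psi> ` Y \<subseteq> \<phi> ` X"
      using assms(1) card_mono[of "\<phi> ` X" "\<psi> ` Y"] by fastforce
    then obtain y where y: "y \<in> Y" "\<psi> y \<notin> \<phi> ` X" by blast
    let ?\<phi> = "\<phi>(y := \<psi> y)"
    have inj: "inj_on ?\<phi> (insert y X)"
    proof -
      have "inj_on ?\<phi> X"
        using less.prems(1) y(2) by (rule inj_on_fun_updI)
      moreover have "?\<phi> ` (X - {y}) \<subseteq> \<phi> ` X" by auto
      ultimately show ?thesis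
        using y(2) unfolding inj_on_insert by auto
    qed
    have val: "\<forall>e\<in>insert y X. ?\<phi> e \<in> {1..s} \<and> e \<in> A (?\<phi> e)"
      using less.prems(2) \<psi>(2) y(1) by auto
    show ?case
    proof (cases "y \<in> X")
      case False
      then show ?thesis
        using inj val y(1) unfolding partial_transversal_def by blast
    next
      case True
      then have ins: "insert y X = X" by blast
      have "{e\<in>X \<inter> Y. ?\<phi> e \<noteq> \<psi> e} \<subset> {e\<in>X \<inter> Y. \<phi> e \<noteq> \<psi> e}"
      proof (rule psubsetI)
        have "\<phi> y \<noteq> \<psi> y" using True y(2) by force
        then have "y \<in> {e\<in>X \<inter> Y. \<phi> e \<noteq> \<psi> e}" using True y(1) by blast
        then show "{e\<in>X \<inter> Y. ?\<phi> e \<noteq> \<psi> e} \<noteq> {e\<in>X \<inter> Y. \<phi> e \<noteq> \<psi> e}" by force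
      qed auto
      then have "card {e\<in>X \<inter> Y. ?\<phi> e \<noteq> \<psi> e} < card {e\<in>X \<inter> Y. \<phi> e \<noteq> \<psi> e}"
        using assms(1) by (intro psubset_card_mono) auto
      from less.hyps[OF this] show ?thesis
        using inj val unfolding ins by blast
    qed
  qed
  then show ?thesis
    using assms(4) unfolding partial_transversal_def by blast
qed

lemma partial_transversal_subset:
  "partial_transversal s A X \<Longrightarrow> Y \<subseteq> X \<Longrightarrow> partial_transversal s A Y"
  unfolding partial_transversal_def by (meson inj_on_subset subsetD)

lemma partial_transversal_empty [simp]: "partial_transversal s A {}"
  by (simp add: partial_transversal_def)

lemma partial_transversal_mono:
  "partial_transversal s A X \<Longrightarrow> \<forall>i\<in>{1..s}. A i \<subseteq> B i \<Longrightarrow> partial_transversal s B X"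
  unfolding partial_transversal_def by blast

lemma is_matroid_matroid_of:
  assumes "finite E"
  shows "is_matroid (matroid_of E s A)"
  unfolding is_matroid_def matroid_of_def
proof (simp add: assms, intro conjI allI impI)
  fix X Y
  assume *: "X \<subseteq> E \<and> partial_transversal s A X \<and> Y \<subseteq> E \<and> partial_transversal s A Y \<and> card X < card Y"
  then have "finite X" "finite Y" using assms finite_subset by blast+
  then show "\<exists>y\<in>Y - X. y \<in> E \<and> partial_transversal s A (insert y X)"
    using partial_transversal_augment[of X Y s A] * by blast
qed (auto intro: partial_transversal_subset)

lemma is_matroid_transversal_matroid:
  assumes "transversal_matroid M"
  shows "is_matroid M"
proof -
  from assms obtain s A where *: "set_system (ground M) s A" "M = matroid_of (ground M) s A"
    unfolding transversal_matroid_def by (elim exE conjE)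
  have "is_matroid (matroid_of (ground M) s A)"
    using *(1) by (intro is_matroid_matroid_of) (simp add: set_system_def)
  then show ?thesis by (simp flip: *(2))
qed

lemma partial_transversal_extend:
  assumes "finite X" "finite Z" "card X \<le> card Z"
    and "partial_transversal s A X" "partial_transversal s A Z"
  shows "\<exists>Y. X \<subseteq> Y \<and> Y \<subseteq> X \<union> Z \<and> card Y = card Z \<and> partial_transversal s A Y"
  using assms
proof (induction "card Z - card X" arbitrary: X)
  case 0
  then show ?case by (intro exI[of _ X]) auto
next
  case (Suc n)
  then have "card X < card Z" by linarith
  then obtain y where y: "y \<in> Z - X" "partial_transversal s A (insert y X)"
    using partial_transversal_augment[of X Z s A] Suc.prems by blast
  have c: "card (insert y X) = Suc (card X)"
    using y(1) Suc.prems(1) by simp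
  have "\<exists>Y. insert y X \<subseteq> Y \<and> Y \<subseteq> insert y X \<union> Z \<and> card Y = card Z \<and> partial_transversal s A Y"
    using Suc.hyps(2) Suc.prems y(2) \<open>card X < card Z\<close> c by (intro Suc.hyps(1)) auto
  then show ?case using y(1) by blast
qed

lemma partial_transversal_without:
  assumes "partial_transversal s A X" "X \<inter> A j = {}"
  shows "partial_transversal s (A(j := {})) X"
  using assms unfolding partial_transversal_def fun_upd_def by (metis IntI empty_iff)

lemma partial_transversal_insert_without:
  assumes "partial_transversal s (A(j := {})) X" "j \<in> {1..s}" "d \<in> A j"
  shows "partial_transversal s A (insert d X)"
proof (cases "d \<in> X")
  case True
  then show ?thesis
    using assms(1) partial_transversal_mono[of s "A(j := {})" X A] by (simp add: insert_absorb)
next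
  case False
  obtain \<phi> where \<phi>: "inj_on \<phi> X" "\<forall>e\<in>X. \<phi> e \<in> {1..s} \<and> e \<in> (A(j := {})) (\<phi> e)"
    using assms(1) unfolding partial_transversal_def by blast
  have nj: "\<phi> e \<noteq> j \<and> e \<in> A (\<phi> e)" if "e \<in> X" for e
    using \<phi>(2) that by (cases "\<phi> e = j") auto
  let ?\<phi> = "\<phi>(d := j)"
  have eq: "?\<phi> e = \<phi> e" if "e \<in> X" for e using that False by auto
  have "inj_on ?\<phi> (insert d X)"
    unfolding inj_on_insert
  proof
    show "inj_on ?\<phi> X" using \<phi>(1) eq inj_on_cong[of X ?\<phi> \<phi>] by blast
    show "?\<phi> d \<notin> ?\<phi> ` (X - {d})" using nj eq by auto
  qed
  moreover have "\<forall>e\<in>insert d X. ?\<phi> e \<in> {1..s} \<and> e \<in> A (?\<phi> e)"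
    using \<phi>(2) nj assms(2,3) by simp
  ultimately show ?thesis unfolding partial_transversal_def by blast
qed

lemma card_partial_transversal_le:
  assumes "partial_transversal s A X"
  shows "card X \<le> card {i\<in>{1..s}. A i \<noteq> {}}"
proof -
  obtain \<phi> where \<phi>: "inj_on \<phi> X" "\<forall>e\<in>X. \<phi> e \<in> {1..s} \<and> e \<in> A (\<phi> e)"
    using assms unfolding partial_transversal_def by blast
  have "\<phi> ` X \<subseteq> {i\<in>{1..s}. A i \<noteq> {}}" using \<phi>(2) by auto
  then show ?thesis
    using card_inj_on_le[OF \<phi>(1)] by simp
qed

lemma card_partial_transversal_without_le:
  assumes "partial_transversal s (A(j := {})) X" "j \<in> {1..s}"
  shows "card X \<le> s - 1"
proof -
  have "card X \<le> card {i\<in>{1..s}. (A(j := {})) i \<noteq> {}}"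
    using assms(1) by (rule card_partial_transversal_le)
  also have "\<dots> \<le> card ({1..s} - {j})"
    by (intro card_mono) auto
  also have "\<dots> = s - 1" using assms(2) by simp
  finally show ?thesis .
qed

lemma is_matroidD:
  assumes "is_matroid M"
  shows "finite (ground M)" "X \<in> indep_sets M \<Longrightarrow> X \<subseteq> ground M" "{} \<in> indep_sets M"
    "X \<in> indep_sets M \<Longrightarrow> Y \<subseteq> X \<Longrightarrow> Y \<in> indep_sets M"
    "X \<in> indep_sets M \<Longrightarrow> Y \<in> indep_sets M \<Longrightarrow> card X < card Y \<Longrightarrow>
      \<exists>y\<in>Y - X. insert y X \<in> indep_sets M"
  using assms unfolding is_matroid_def by simp_all

lemma finite_indep_sets:
  assumes "is_matroid M"
  shows "finite (indep_sets M)"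
proof (rule finite_subset)
  show "indep_sets M \<subseteq> Pow (ground M)" "finite (Pow (ground M))"
    using is_matroidD(1,2)[OF assms] by auto
qed

lemma card_le_matroid_rank:
  "is_matroid M \<Longrightarrow> X \<in> indep_sets M \<Longrightarrow> card X \<le> matroid_rank M"
  unfolding matroid_rank_def by (intro Max_ge) (auto simp: finite_indep_sets)

lemma ex_card_eq_matroid_rank:
  assumes "is_matroid M"
  shows "\<exists>X\<in>indep_sets M. card X = matroid_rank M"
proof -
  have "card ` indep_sets M \<noteq> {}" using is_matroidD(3)[OF assms] by blast
  then have "Max (card ` indep_sets M) \<in> card ` indep_sets M"
    using assms by (intro Max_in) (auto simp: finite_indep_sets)
  then show ?thesis unfolding matroid_rank_def by auto
qed

lemma is_matroid_deletion:
  assumes "is_matroid M"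
  shows "is_matroid (deletion M D)"
  unfolding is_matroid_def deletion_def fst_conv snd_conv
proof (intro conjI allI impI)
  fix X Y
  assume *: "X \<in> {Y \<in> indep_sets M. Y \<inter> D = {}} \<and> Y \<in> {Y \<in> indep_sets M. Y \<inter> D = {}} \<and>
    card X < card Y"
  then obtain y where "y \<in> Y - X" "insert y X \<in> indep_sets M"
    using is_matroidD(5)[OF assms, of X Y] by auto
  with * show "\<exists>y\<in>Y - X. insert y X \<in> {Y \<in> indep_sets M. Y \<inter> D = {}}" by blast
next
  show "finite (ground M - D)" using is_matroidD(1)[OF assms] by blast
next
  show "\<forall>X\<in>{Y \<in> indep_sets M. Y \<inter> D = {}}. X \<subseteq> ground M - D"
    using is_matroidD(2)[OF assms] by blast
next
  show "{} \<in> {Y \<in> indep_sets M. Y \<inter> D = {}}"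
    using is_matroidD(3)[OF assms] by blast
next
  fix X Y
  assume *: "X \<in> {Y \<in> indep_sets M. Y \<inter> D = {}} \<and> Y \<subseteq> X"
  then have "Y \<in> indep_sets M" using is_matroidD(4)[OF assms] by blast
  then show "Y \<in> {Y \<in> indep_sets M. Y \<inter> D = {}}" using * by blast
qed

lemma presentation_indep:
  assumes "presentation M A"
  shows "X \<in> indep_sets M \<longleftrightarrow> X \<subseteq> ground M \<and> partial_transversal (matroid_rank M) A X"
proof -
  have "M = matroid_of (ground M) (matroid_rank M) A"
    using assms unfolding presentation_def by (elim conjE)
  then have "indep_sets M = {X. X \<subseteq> ground M \<and> partial_transversal (matroid_rank M) A X}"
    unfolding matroid_of_def by (metis snd_conv)
  then show ?thesis by blast
qed

lemma presentationI:
  assumes "set_system (ground M) (matroid_rank M) A"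
    and "\<And>X. X \<subseteq> ground M \<Longrightarrow> X \<in> indep_sets M \<longleftrightarrow> partial_transversal (matroid_rank M) A X"
    and "\<And>X. X \<in> indep_sets M \<Longrightarrow> X \<subseteq> ground M"
  shows "presentation M A"
  unfolding presentation_def
proof
  have "indep_sets M = {X. X \<subseteq> ground M \<and> partial_transversal (matroid_rank M) A X}"
    using assms(2,3) by blast
  then show "M = matroid_of (ground M) (matroid_rank M) A"
    unfolding matroid_of_def by (simp add: prod_eq_iff)
qed (rule assms(1))

lemma is_matroid_presentation:
  assumes "presentation M A"
  shows "is_matroid M"
proof (rule is_matroid_transversal_matroid)
  show "transversal_matroid M"
    using assms unfolding presentation_def transversal_matroid_def by (intro exI)
qed

lemma presentation_sandwich:
  assumes A: "presentation M A" and B: "presentation M B"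
    and le: "pres_le (matroid_rank M) A C" "pres_le (matroid_rank M) C B"
  shows "presentation M C"
proof (rule presentationI)
  have "set_system (ground M) (matroid_rank M) B"
    using B unfolding presentation_def by (elim conjE)
  then show "set_system (ground M) (matroid_rank M) C"
    using le(2) unfolding set_system_def pres_le_def by blast
next
  fix X assume X: "X \<subseteq> ground M"
  show "X \<in> indep_sets M \<longleftrightarrow> partial_transversal (matroid_rank M) C X"
    using presentation_indep[OF A, of X] presentation_indep[OF B, of X] X le
      partial_transversal_mono[of "matroid_rank M" A X C]
      partial_transversal_mono[of "matroid_rank M" C X B] unfolding pres_le_def by blast
next
  fix X assume "X \<in> indep_sets M"
  then show "X \<subseteq> ground M" using presentation_indep[OF A] by blast
qed

lemma deletion_rank_insert:
  assumes A: "presentation M A" and B: "presentation M B"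
    and B_def: "B = A(j := insert x (A j))" and j: "j \<in> {1..matroid_rank M}" and x: "x \<notin> A j"
  shows "matroid_rank (deletion M (A j)) = Suc (matroid_rank (deletion M (B j)))"
proof -
  let ?r = "matroid_rank M"
  note M = is_matroid_presentation[OF A]
  note DA = is_matroid_deletion[OF M, of "A j"] and DB = is_matroid_deletion[OF M, of "B j"]
  have xg: "x \<in> ground M"
  proof -
    have "set_system (ground M) ?r B"
      using B unfolding presentation_def by (elim conjE)
    then have "B j \<subseteq> ground M" using j unfolding set_system_def by blast
    then show ?thesis unfolding B_def by simp
  qed
  have fin: "finite X" if "X \<in> indep_sets M" for X
    using is_matroidD(1,2)[OF M] that finite_subset by blast
  obtain Y where Y: "Y \<in> indep_sets (deletion M (B j))" "card Y = matroid_rank (deletion M (B j))"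
    using ex_card_eq_matroid_rank[OF DB] by blast
  have YM: "Y \<in> indep_sets M" "Y \<inter> A j = {}" "x \<notin> Y"
    using Y(1) unfolding deletion_def B_def by auto
  have eqs: "A(j := {}) = B(j := {})" unfolding B_def by simp
  have "partial_transversal ?r (B(j := {})) Y"
    using partial_transversal_without[of ?r A Y j] YM presentation_indep[OF A] eqs by metis
  then have "partial_transversal ?r B (insert x Y)"
    using j by (rule partial_transversal_insert_without) (simp add: B_def)
  then have "insert x Y \<in> indep_sets M"
    using presentation_indep[OF B] YM xg by auto
  then have "insert x Y \<in> indep_sets (deletion M (A j))"
    using YM x unfolding deletion_def by auto
  from card_le_matroid_rank[OF DA this] have 1: "Suc (card Y) \<le> matroid_rank (deletion M (A j))"
    using YM fin by simp
  obtain Z where Z: "Z \<in> indep_sets (deletion M (A j))" "card Z = matroid_rank (deletion M (A j))"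
    using ex_card_eq_matroid_rank[OF DA] by blast
  have ZM: "Z \<in> indep_sets M" "Z \<inter> A j = {}"
    using Z(1) unfolding deletion_def by auto
  have "Z - {x} \<in> indep_sets M" using is_matroidD(4)[OF M ZM(1)] by blast
  then have "Z - {x} \<in> indep_sets (deletion M (B j))"
    using ZM unfolding deletion_def B_def by auto
  from card_le_matroid_rank[OF DB this] have "card Z - 1 \<le> matroid_rank (deletion M (B j))"
    using card_Diff1_le[of Z x] fin[OF ZM(1)] by (cases "x \<in> Z") auto
  with 1 Y Z show ?thesis by linarith
qed

lemma presentation_rank_cong:
  "(\<And>i. i \<in> {1..matroid_rank M} \<Longrightarrow> A i = B i) \<Longrightarrow> presentation_rank M A = presentation_rank M B"
  unfolding presentation_rank_def by (intro arg_cong2[of _ _ _ _ minus] refl sum.cong) simp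

lemma presentation_rank_insert:
  assumes "presentation M A" "presentation M (A(j := insert x (A j)))"
    and j: "j \<in> {1..matroid_rank M}" and "x \<notin> A j"
  shows "presentation_rank M (A(j := insert x (A j))) = presentation_rank M A + 1"
proof -
  let ?B = "A(j := insert x (A j))" and ?J = "{1..matroid_rank M}"
  let ?f = "\<lambda>A i. int (matroid_rank (deletion M (A i)))"
  have "?f A j = ?f ?B j + 1"
    using deletion_rank_insert[OF assms(1,2) refl assms(3,4)] by simp
  moreover have "sum (?f A) ?J = ?f A j + sum (?f A) (?J - {j})"
    using j by (intro sum.remove) auto
  moreover have "sum (?f ?B) ?J = ?f ?B j + sum (?f ?B) (?J - {j})"
    using j by (intro sum.remove) auto
  moreover have "sum (?f ?B) (?J - {j}) = sum (?f A) (?J - {j})"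
    by (intro sum.cong) auto
  ultimately show ?thesis unfolding presentation_rank_def by linarith
qed

lemma presentation_rank_cover:
  assumes A: "presentation M A" and B: "presentation M B"
    and le: "pres_le (matroid_rank M) A B" and ne: "\<not> pres_le (matroid_rank M) B A"
    and cover: "\<And>C. presentation M C \<Longrightarrow> pres_le (matroid_rank M) A C \<Longrightarrow>
      pres_le (matroid_rank M) C B \<Longrightarrow> \<not> pres_le (matroid_rank M) C A \<Longrightarrow>
      pres_le (matroid_rank M) B C"
  shows "presentation_rank M B = presentation_rank M A + 1"
proof -
  obtain j x where j: "j \<in> {1..matroid_rank M}" and x: "x \<in> B j" "x \<notin> A j"
    using ne unfolding pres_le_def by blast
  let ?C = "A(j := insert x (A j))"
  have AC: "pres_le (matroid_rank M) A ?C" unfolding pres_le_def by auto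
  have CB: "pres_le (matroid_rank M) ?C B" using le x unfolding pres_le_def by auto
  have C: "presentation M ?C" by (rule presentation_sandwich[OF A B AC CB])
  have "\<not> pres_le (matroid_rank M) ?C A" using j x unfolding pres_le_def by auto
  from cover[OF C AC CB this] have "pres_le (matroid_rank M) B ?C" .
  with CB have "presentation_rank M B = presentation_rank M ?C"
    unfolding pres_le_def by (intro presentation_rank_cong) blast
  then show ?thesis using presentation_rank_insert[OF A C j x(2)] by simp
qed

lemma presentation_rank_minimal:
  assumes A: "presentation M A"
    and minimal: "\<And>C. presentation M C \<Longrightarrow> pres_le (matroid_rank M) C A \<Longrightarrow>
      pres_le (matroid_rank M) A C"
  shows "presentation_rank M A = 0"
proof -
  let ?r = "matroid_rank M"
  note M = is_matroid_presentation[OF A]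
  note indep = presentation_indep[OF A]
  have fin: "finite X" if "X \<subseteq> ground M" for X
    using is_matroidD(1)[OF M] that finite_subset by blast
  have "matroid_rank (deletion M (A j)) = ?r - 1" if j: "j \<in> {1..?r}" for j
  proof -
    let ?P = "partial_transversal ?r (A(j := {}))"
    note D = is_matroid_deletion[OF M, of "A j"]
    obtain Y where Y: "Y \<in> indep_sets (deletion M (A j))"
        "card Y = matroid_rank (deletion M (A j))"
      using ex_card_eq_matroid_rank[OF D] by blast
    have YM: "Y \<subseteq> ground M" "Y \<inter> A j = {}" "partial_transversal ?r A Y"
      using Y(1) indep unfolding deletion_def by auto
    have PY: "?P Y" using YM(3,2) by (rule partial_transversal_without)
    have max: "card X \<le> card Y" if "X \<subseteq> ground M" "X \<inter> A j = {}" "?P X" for X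
    proof -
      have "partial_transversal ?r A X"
        using that(3) by (rule partial_transversal_mono) auto
      then have "X \<in> indep_sets (deletion M (A j))"
        using that indep unfolding deletion_def by auto
      then show ?thesis using card_le_matroid_rank[OF D] Y(2) by simp
    qed
    have "card Y = ?r - 1"
    proof (rule ccontr)
      assume "card Y \<noteq> ?r - 1"
      with card_partial_transversal_without_le[OF PY j] have less: "card Y < ?r - 1" by linarith
      obtain Z where Z: "Z \<in> indep_sets M" "card Z = ?r"
        using ex_card_eq_matroid_rank[OF M] by blast
      then have Zg: "Z \<subseteq> ground M" and "partial_transversal ?r A Z" using indep by auto
      then obtain \<phi> where \<phi>: "inj_on \<phi> Z" "\<forall>e\<in>Z. \<phi> e \<in> {1..?r} \<and> e \<in> A (\<phi> e)"
        unfolding partial_transversal_def by blast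
      have im: "\<phi> ` Z = {1..?r}"
        using \<phi> Z(2) by (intro card_subset_eq) (auto simp: card_image)
      then obtain z where z: "z \<in> Z" "\<phi> z = j" using j by (metis imageE)
      have "?P (Z - {z})"
        unfolding partial_transversal_def
      proof (intro exI[of _ \<phi>] conjI ballI)
        show "inj_on \<phi> (Z - {z})" using \<phi>(1) by (rule inj_on_subset) auto
        fix e assume e: "e \<in> Z - {z}"
        then have "\<phi> e \<noteq> j" using z \<phi>(1) unfolding inj_on_def by blast
        then show "\<phi> e \<in> {1..?r}" "e \<in> (A(j := {})) (\<phi> e)" using \<phi>(2) e by auto
      qed
      moreover have "card (Z - {z}) = ?r - 1" using Z(2) z(1) fin[OF Zg] by simp
      ultimately obtain y where y: "y \<in> Z - {z} - Y" "?P (insert y Y)"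
        using partial_transversal_augment[of Y "Z - {z}" ?r "A(j := {})"] PY less
          fin[OF YM(1)] fin[OF Zg] by auto
      have yg: "y \<in> ground M" "y \<notin> Y" using y(1) Zg by auto
      have cY: "card (insert y Y) = Suc (card Y)" using yg fin[OF YM(1)] by simp
      have yA: "y \<in> A j"
      proof (rule ccontr)
        assume "y \<notin> A j"
        then have "card (insert y Y) \<le> card Y"
          using y(2) yg YM by (intro max) auto
        with cY show False by simp
      qed
      let ?C = "A(j := A j - {y})"
      have CA: "pres_le ?r ?C A" unfolding pres_le_def by auto
      have eqs: "?C(j := {}) = A(j := {})" by simp
      have key: "partial_transversal ?r ?C W"
        if W: "W \<subseteq> ground M" "partial_transversal ?r A W" for W
      proof -
        obtain \<theta> where \<theta>: "inj_on \<theta> W" "\<forall>e\<in>W. \<theta> e \<in> {1..?r} \<and> e \<in> A (\<theta> e)"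
          using W(2) unfolding partial_transversal_def by blast
        show ?thesis
        proof (cases "y \<in> W \<and> \<theta> y = j")
          case False
          then have "\<forall>e\<in>W. \<theta> e \<in> {1..?r} \<and> e \<in> ?C (\<theta> e)" using \<theta>(2) by auto
          then show ?thesis using \<theta>(1) unfolding partial_transversal_def by blast
        next
          case True
          have P1: "?P (W - {y})"
            unfolding partial_transversal_def
          proof (intro exI[of _ \<theta>] conjI ballI)
            show "inj_on \<theta> (W - {y})" using \<theta>(1) by (rule inj_on_subset) auto
            fix e assume e: "e \<in> W - {y}"
            then have "\<theta> e \<noteq> j" using True \<theta>(1) unfolding inj_on_def by blast
            then show "\<theta> e \<in> {1..?r}" "e \<in> (A(j := {})) (\<theta> e)" using \<theta>(2) e by auto
          qed
          let ?W0 = "W - A j"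
          have W0: "?W0 \<subseteq> ground M" "?W0 \<inter> A j = {}" "y \<notin> ?W0" using W(1) yA by auto
          have PW0: "?P ?W0" using P1 yA by (auto elim!: partial_transversal_subset)
          obtain Y' where Y': "?W0 \<subseteq> Y'" "Y' \<subseteq> ?W0 \<union> Y" "card Y' = card Y" "?P Y'"
            using partial_transversal_extend[OF fin[OF W0(1)] fin[OF YM(1)] max[OF W0(1,2) PW0] PW0 PY]
            by blast
          have Y'g: "Y' \<subseteq> ground M" "Y' \<inter> A j = {}" using Y'(2) W0 YM by auto
          obtain u where u: "u \<in> insert y Y - Y'" "?P (insert u Y')"
            using partial_transversal_augment[of Y' "insert y Y" ?r "A(j := {})"]
              fin[OF Y'g(1)] fin[OF YM(1)] Y'(3,4) cY y(2) by auto
          have "u = y"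
          proof (rule ccontr)
            assume "u \<noteq> y"
            then have "u \<in> Y" using u(1) by blast
            then have "card (insert u Y') \<le> card Y"
              using u(2) YM Y'g by (intro max) auto
            then show False using u(1) Y'(3) fin[OF Y'g(1)] by simp
          qed
          then have PV: "?P (insert y ?W0)"
            using u(2) Y'(1) by (auto elim!: partial_transversal_subset)
          have finW: "finite W" by (rule fin[OF W(1)])
          have Vsub: "insert y ?W0 \<subseteq> W" using True by blast
          show ?thesis
          proof (cases "insert y ?W0 = W")
            case True
            then have "?P W" using PV by simp
            then show ?thesis by (rule partial_transversal_mono) auto
          next
            case False
            then have "card (insert y ?W0) < card W"
              using Vsub finW by (intro psubset_card_mono) auto
            moreover have cW: "card (W - {y}) = card W - 1" using True finW by simp
            ultimately have "card (insert y ?W0) \<le> card (W - {y})" by linarith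
            then obtain V where V: "insert y ?W0 \<subseteq> V" "V \<subseteq> insert y ?W0 \<union> (W - {y})"
                "card V = card (W - {y})" "?P V"
              using partial_transversal_extend[of "insert y ?W0" "W - {y}" ?r "A(j := {})"]
                PV P1 finW by auto
            have VW: "V \<subseteq> W" using V(2) Vsub by blast
            have "card W > 0" using True finW card_gt_0_iff by blast
            then have "card (W - V) = 1"
              using VW V(3) cW finW by (simp add: card_Diff_subset finite_subset)
            then obtain d where d: "W - V = {d}" by (auto simp: card_1_singleton_iff)
            then have ins: "insert d V = W" using VW by blast
            have "d \<in> ?C j" using d V(1) by auto
            moreover have "partial_transversal ?r (?C(j := {})) V" using V(4) eqs by simp
            ultimately have "partial_transversal ?r ?C (insert d V)"
              using j by (intro partial_transversal_insert_without)
            then show ?thesis using ins by simp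
          qed
        qed
      qed
      have "presentation M ?C"
      proof (rule presentationI)
        have "set_system (ground M) ?r A"
          using A unfolding presentation_def by (elim conjE)
        then show "set_system (ground M) ?r ?C"
          unfolding set_system_def by auto
      next
        fix X assume "X \<subseteq> ground M"
        then show "X \<in> indep_sets M \<longleftrightarrow> partial_transversal ?r ?C X"
          using indep key[of X] CA partial_transversal_mono[of ?r ?C X A]
          unfolding pres_le_def by blast
      next
        fix X assume "X \<in> indep_sets M"
        then show "X \<subseteq> ground M" using indep by blast
      qed
      from minimal[OF this CA] have "A j \<subseteq> ?C j" using j unfolding pres_le_def by blast
      then show False using yA by auto
    qed
    with Y(2) show ?thesis by simp
  qed
  then have "(\<Sum>i=1..?r. int (matroid_rank (deletion M (A i)))) = (\<Sum>i=1..?r. int (?r - 1))"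
    by (intro sum.cong) auto
  also have "\<dots> = int ?r * (int ?r - 1)" by (cases ?r) auto
  finally show ?thesis unfolding presentation_rank_def by simp
qed

end

theory Submission
  imports Defs
begin

text \<open>
  For a partial transversal \<open>X\<close> of \<open>A\<close> let \<open>U(X)\<close> be the set of indices \<open>j\<close> that some matching of
  \<open>X\<close> leaves unused, that is, such that \<open>X\<close> is a partial transversal of \<open>A(j := {})\<close>. Then
  \<open>X \<union> {x}\<close> is independent in \<open>M[A\<^sup>I]\<close> iff \<open>U(X)\<close> meets \<open>I\<close>. All bases \<open>B\<close> of \<open>M \ A\<^sub>k\<close> have the
  same \<open>U(B)\<close>, say \<open>U\<^sub>k\<close>, and \<open>x\<close> is a coloop of \<open>M[A\<^sup>I] \ A\<^sub>k\<close> iff \<open>U\<^sub>k\<close> meets \<open>I\<close>. Hence the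
  complements of the members of \<open>L\<^sub>A\<close> are the sets \<open>V\<close> of indices that contain \<open>U\<^sub>k\<close> for each
  \<open>k \<in> V\<close>. Since \<open>k \<in> U\<^sub>k\<close> and \<open>U\<^sub>k\<close> has at least \<open>r - r(M \ A\<^sub>k)\<close> elements, these are the closed
  sets of an irreflexive relation on \<open>[r]\<close> with at least as many pairs as the rank of the
  presentation, and it remains to bound the number of closed sets of a relation with \<open>e\<close> pairs by
  \<open>2\<^sup>r (1 + 2\<^sup>-\<^sup>e) / 2\<close>. The free matroid on \<open>[r]\<close> with \<open>A\<^sub>1 = [i + 1]\<close> and \<open>A\<^sub>k = {k}\<close> for \<open>k > 1\<close>
  attains the bound.
\<close>

section \<open>Counting the closed sets of an irreflexive relation\<close>

lemma card_subsets_above: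
  assumes "finite S" "P \<subseteq> S"
  shows "card {V. P \<subseteq> V \<and> V \<subseteq> S} = 2 ^ (card S - card P)"
proof -
  have "bij_betw (\<lambda>W. W \<union> P) (Pow (S - P)) {V. P \<subseteq> V \<and> V \<subseteq> S}"
    by (rule bij_betw_byWitness[where f' = "\<lambda>V. V - P"]) (use assms(2) in auto)
  then have "card {V. P \<subseteq> V \<and> V \<subseteq> S} = card (Pow (S - P))"
    by (simp add: bij_betw_same_card)
  also have "\<dots> = 2 ^ (card S - card P)"
    using assms by (simp add: card_Pow card_Diff_subset finite_subset)
  finally show ?thesis .
qed

text \<open>
  Induction on \<open>S\<close>: split the closed sets by whether they contain a vertex \<open>v\<close> with a successor. If
  \<open>v\<close> also has a predecessor, each part is at most a quarter of all subsets. Otherwise the sets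
  avoiding \<open>v\<close> are the closed sets of the relation on \<open>S - {v}\<close>, and those containing \<open>v\<close> contain
  its \<open>p\<close> successors; with \<open>a = 2\<^sup>-\<^sup>p\<close> and \<open>E = 2\<^sup>-\<^sup>(\<^sup>e\<^sup>-\<^sup>p\<^sup>)\<close> the bound reduces to
  \<open>(1 / 2 - a) (1 - E) \<ge> 0\<close>.
\<close>

lemma card_relation_closed_le:
  assumes "finite S" "R \<subseteq> S \<times> S" "\<And>v. (v, v) \<notin> R"
  shows "real (card {V. V \<subseteq> S \<and> (\<forall>(v, w)\<in>R. v \<in> V \<longrightarrow> w \<in> V)})
    \<le> (1 / 2 + 1 / 2 ^ (card R + 1)) * 2 ^ card S"
  using assms
proof (induction "card S" arbitrary: S R)
  case 0
  then have "S = {}" "R = {}" by auto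
  then show ?case by simp
next
  case (Suc n)
  let ?C = "{V. V \<subseteq> S \<and> (\<forall>(v, w)\<in>R. v \<in> V \<longrightarrow> w \<in> V)}"
  have cS: "card S = Suc n" using Suc.hyps(2) by simp
  have finR: "finite R" using Suc.prems(1,2) by (meson finite_SigmaI finite_subset)
  show ?case
  proof (cases "R = {}")
    case True
    then have "?C = Pow S" by auto
    then show ?thesis using True Suc.prems(1) by (simp add: card_Pow)
  next
    case False
    then obtain v w where vw: "(v, w) \<in> R" by fastforce
    then have vS: "v \<in> S" "w \<in> S" "w \<noteq> v" using Suc.prems(2,3) by auto
    let ?N = "{V\<in>?C. v \<notin> V}" and ?Y = "{V\<in>?C. v \<in> V}"
    have "finite ?N" "finite ?Y" using Suc.prems(1) by simp_all
    then have "card (?N \<union> ?Y) = card ?N + card ?Y"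
      by (intro card_Un_disjoint) auto
    moreover have "?N \<union> ?Y = ?C" by blast
    ultimately have split: "card ?C = card ?N + card ?Y" by simp
    let ?P = "insert v (R `` {v})"
    have PS: "?P \<subseteq> S" using vS Suc.prems(2) by auto
    then have finP: "finite ?P" using Suc.prems(1) by (rule finite_subset)
    let ?p = "card (R `` {v})"
    have cP: "card ?P = Suc ?p" using finP Suc.prems(3) by simp
    have pn: "?p \<le> n" using card_mono[OF Suc.prems(1) PS] cP cS by simp
    have p1: "1 \<le> ?p" using vw finP by (simp add: card_gt_0_iff Suc_le_eq) blast
    have "?Y \<subseteq> {V. ?P \<subseteq> V \<and> V \<subseteq> S}" by auto
    then have "card ?Y \<le> card {V. ?P \<subseteq> V \<and> V \<subseteq> S}"
      using Suc.prems(1) by (intro card_mono) auto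
    then have Y: "card ?Y \<le> 2 ^ (n - ?p)"
      using card_subsets_above[OF Suc.prems(1) PS] cP cS by simp
    show ?thesis
    proof (cases "\<exists>u. (u, v) \<in> R")
      case True
      then obtain u where u: "(u, v) \<in> R" by blast
      then have uS: "u \<in> S" "u \<noteq> v" using Suc.prems(2,3) by auto
      \<comment> \<open>A closed set that avoids \<open>v\<close> avoids its predecessor
        \<open>u\<close> too.\<close>
      have "?N \<subseteq> Pow (S - {u, v})" using u by auto
      then have "card ?N \<le> card (Pow (S - {u, v}))"
        using Suc.prems(1) by (intro card_mono) auto
      also have "\<dots> = 2 ^ (n - 1)"
        using uS vS Suc.prems(1) cS by (simp add: card_Pow card_Diff_subset)
      finally have N: "card ?N \<le> 2 ^ (n - 1)" .
      have "card ?Y \<le> 2 ^ (n - 1)"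
        using Y p1 power_increasing[of "n - ?p" "n - 1" "2::nat"] by linarith
      with N split have "card ?C \<le> 2 * 2 ^ (n - 1)" by linarith
      also have "\<dots> = 2 ^ n" using p1 pn by (simp flip: power_Suc)
      finally have "real (card ?C) \<le> real (2 ^ n)" unfolding of_nat_le_iff .
      \<comment> \<open>Two quarters make half of all subsets, which is below the bound whatever the
        size of \<open>R\<close>.\<close>
      also have "real (2 ^ n) \<le> (1 / 2 + 1 / 2 ^ (card R + 1)) * 2 ^ card S"
        unfolding cS by (simp add: algebra_simps)
      finally show ?thesis .
    next
      case False
      let ?R = "R - {v} \<times> (R `` {v})"
      let ?D = "{V. V \<subseteq> S - {v} \<and> (\<forall>(v, w)\<in>?R. v \<in> V \<longrightarrow> w \<in> V)}"
      have "card ?R = card R - card ({v} \<times> (R `` {v}))"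
        using finR by (intro card_Diff_subset) (auto intro: finite_subset)
      moreover have "card ({v} \<times> (R `` {v})) \<le> card R"
        using finR by (intro card_mono) auto
      ultimately have cR: "card R = card ?R + ?p" by (simp add: card_cartesian_product)
      have cSv: "card (S - {v}) = n" using vS Suc.prems(1) cS by simp
      have "?R \<subseteq> (S - {v}) \<times> (S - {v})" using Suc.prems(2) False by auto
      then have "real (card ?D) \<le> (1 / 2 + 1 / 2 ^ (card ?R + 1)) * 2 ^ n"
        using Suc.hyps(1)[of "S - {v}" ?R] cSv Suc.prems by auto
      moreover have "?N \<subseteq> ?D" by blast
      then have "card ?N \<le> card ?D" using Suc.prems(1) by (intro card_mono) auto
      moreover have "real (card ?Y) \<le> 2 ^ n / 2 ^ ?p"
        using of_nat_mono[OF Y, where 'a = real] pn by (simp add: power_diff[where 'a = real])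
      ultimately have 1: "real (card ?C) \<le>
          (1 / 2 + 1 / 2 ^ (card ?R + 1)) * 2 ^ n + 2 ^ n / 2 ^ ?p"
        unfolding split by simp
      define a E :: real where "a = 1 / 2 ^ ?p" and "E = 1 / 2 ^ card ?R"
      have aE: "a \<le> 1 / 2" "E \<le> 1"
        using power_increasing[OF p1, of "2::real"] by (auto simp: a_def E_def field_simps)
      have "0 \<le> (1 / 2 - a) * (1 - E)" using aE by simp
      then have "(1 / 2 + E / 2) + a \<le> (1 / 2 + a * E / 2) * 2"
        by (simp add: field_simps)
      then have "((1 / 2 + E / 2) + a) * 2 ^ n \<le> (1 / 2 + a * E / 2) * 2 * 2 ^ n"
        by (rule mult_right_mono) simp
      moreover have "((1 / 2 + E / 2) + a) * 2 ^ n =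
          (1 / 2 + 1 / 2 ^ (card ?R + 1)) * 2 ^ n + 2 ^ n / 2 ^ ?p"
        unfolding a_def E_def by (simp add: algebra_simps)
      moreover have "(1 / 2 + a * E / 2) * 2 * 2 ^ n = (1 / 2 + 1 / 2 ^ (card R + 1)) * 2 ^ card S"
        unfolding a_def E_def cS by (subst cR) (simp add: power_add field_simps)
      ultimately show ?thesis using 1 by linarith
    qed
  qed
qed

lemma card_basis:
  assumes "is_matroid M" "basis M B"
  shows "card B = matroid_rank M"
proof (rule ccontr)
  have B: "B \<in> indep_sets M" using assms(2) unfolding basis_def by blast
  obtain X where X: "X \<in> indep_sets M" "card X = matroid_rank M"
    using ex_card_eq_matroid_rank[OF assms(1)] by blast
  assume "card B \<noteq> matroid_rank M"
  then have "card B < card X" using card_le_matroid_rank[OF assms(1) B] X(2) by simp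
  then obtain y where "y \<in> X - B" "insert y B \<in> indep_sets M"
    using is_matroidD(5)[OF assms(1) B X(1)] by blast
  then show False using assms(2) unfolding basis_def by blast
qed

lemma indep_subset_basis:
  assumes "is_matroid M" "X \<in> indep_sets M"
  shows "\<exists>B. basis M B \<and> X \<subseteq> B"
proof -
  have "\<exists>B\<in>indep_sets M. X \<subseteq> B \<and> (\<forall>C\<in>indep_sets M. B \<subseteq> C \<longrightarrow> B = C)"
    by (rule finite_has_maximal2[OF finite_indep_sets[OF assms(1)] assms(2)])
  then show ?thesis unfolding basis_def by (metis (no_types))
qed

text \<open>A matching of \<open>X\<close> avoids \<open>j\<close> once the element \<open>d\<close>
  that it sends to \<open>j\<close> is dropped. If there is no such element, then
  \<open>Y = X\<close> and any \<open>d\<close> will do.\<close>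

lemma partial_transversal_remove_one:
  assumes "partial_transversal s A X"
  shows "\<exists>Y d. X \<subseteq> insert d Y \<and> Y \<subseteq> X \<and> (d \<in> A j \<or> X = Y) \<and> card X \<le> Suc (card Y) \<and>
    partial_transversal s (A(j := {})) Y"
proof -
  obtain \<phi> where \<phi>: "inj_on \<phi> X" "\<forall>e\<in>X. \<phi> e \<in> {1..s} \<and> e \<in> A (\<phi> e)"
    using assms unfolding partial_transversal_def by blast
  show ?thesis
  proof (cases "\<exists>d\<in>X. \<phi> d = j")
    case True
    then obtain d where d: "d \<in> X" "\<phi> d = j" by blast
    have "partial_transversal s (A(j := {})) (X - {d})"
      unfolding partial_transversal_def
    proof (intro exI[of _ \<phi>] conjI ballI)
      show "inj_on \<phi> (X - {d})" using \<phi>(1) by (rule inj_on_subset) auto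
      fix e assume e: "e \<in> X - {d}"
      then have "\<phi> e \<noteq> j" using d \<phi>(1) unfolding inj_on_def by blast
      then show "\<phi> e \<in> {1..s}" "e \<in> (A(j := {})) (\<phi> e)" using \<phi>(2) e by auto
    qed
    moreover have "card X \<le> Suc (card (X - {d}))" by (simp add: card_Diff_singleton_if) linarith
    ultimately show ?thesis using d \<phi>(2) by (intro exI[of _ "X - {d}"] exI[of _ d]) auto
  next
    case False
    then have "partial_transversal s (A(j := {})) X"
      using \<phi> unfolding partial_transversal_def by (intro exI[of _ \<phi>]) auto
    then show ?thesis by (intro exI[of _ X] exI) auto
  qed
qed

lemma partial_transversal_avoid_exchange:
  assumes fin: "finite X" and X: "partial_transversal s (A(k := {})) X" and k: "k \<in> {1..s}"
    and j: "partial_transversal s (A(j := {})) (X - A k)"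
  shows "partial_transversal s (A(j := {})) X"
proof (cases "j = k")
  case True
  then show ?thesis using X by simp
next
  case False
  let ?P = "partial_transversal s (A(k := {}, j := {}))"
  have "partial_transversal s (A(j := {}, k := {})) (X - A k)"
    using j by (rule partial_transversal_without) (use False in auto)
  then have P: "?P (X - A k)" using False by (simp add: fun_upd_twist)
  obtain Y where Y: "Y \<subseteq> X" "card X \<le> Suc (card Y)" "?P Y"
    using partial_transversal_remove_one[OF X, of j] by blast
  note finY = finite_subset[OF Y(1) fin]
  obtain Z where Z: "X - A k \<subseteq> Z" "Z \<subseteq> X" "card X \<le> Suc (card Z)" "?P Z"
  proof (cases "card (X - A k) \<le> card Y")
    case True
    obtain Z where Z: "X - A k \<subseteq> Z" "Z \<subseteq> (X - A k) \<union> Y" "card Z = card Y" "?P Z"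
      using partial_transversal_extend[OF finite_Diff[OF fin] finY True P Y(3)] by blast
    have "Z \<subseteq> X" using Z(2) Y(1) by blast
    then show ?thesis using that[of Z] Z Y(2) by simp
  next
    case False
    then show ?thesis using that[of "X - A k"] P Y(2) by auto
  qed
  have P': "partial_transversal s ((A(j := {}))(k := {})) Z"
    using Z(4) False by (simp add: fun_upd_twist)
  show ?thesis
  proof (cases "Z = X")
    case True
    show ?thesis
      using P' unfolding True by (rule partial_transversal_mono) auto
  next
    case ne: False
    then have "card Z < card X" using fin Z(2) by (intro psubset_card_mono) auto
    then have "card (X - Z) = 1"
      using Z fin by (simp add: card_Diff_subset finite_subset)
    then obtain d where d: "X - Z = {d}" by (auto simp: card_1_singleton_iff)
    then have "d \<in> (A(j := {})) k" using Z(1) False by auto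
    from partial_transversal_insert_without[OF P' k this] show ?thesis
      using d Z(2) by (metis Diff_partition insert_is_Un sup_commute)
  qed
qed

lemma basis_deletion_iff:
  "basis (deletion (matroid_of E r A) D) B \<longleftrightarrow>
    B \<subseteq> E - D \<and> partial_transversal r A B \<and>
    (\<forall>C. C \<subseteq> E - D \<and> partial_transversal r A C \<and> B \<subseteq> C \<longrightarrow> C = B)"
  unfolding basis_def deletion_def matroid_of_def by auto

lemma basis_deletion_maximal:
  assumes "basis (deletion (matroid_of E r A) D) B"
    and "C \<subseteq> E - D" "partial_transversal r A C" "B \<subseteq> C"
  shows "C = B"
  using assms unfolding basis_deletion_iff by blast

text \<open>If a matching of \<open>B'\<close> sends \<open>d\<close> to \<open>j\<close>, the rest
  \<open>Y\<close> of \<open>B'\<close> avoids \<open>j\<close> and is smaller than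
  \<open>B\<close>, so in the system without \<open>A j\<close> it can be augmented by some
  \<open>b\<close> from \<open>B\<close>. For \<open>b = d\<close> this matches \<open>B'\<close>
  without \<open>j\<close>. Otherwise sending \<open>d\<close> to \<open>j\<close> again would match
  \<open>B'\<close> together with \<open>b\<close>, against the maximality of
  \<open>B'\<close>.\<close>

lemma basis_deletion_avoid_cong:
  assumes "finite E" "j \<in> {1..r}"
    and B: "basis (deletion (matroid_of E r A) D) B"
    and B': "basis (deletion (matroid_of E r A) D) B'"
    and j: "partial_transversal r (A(j := {})) B"
  shows "partial_transversal r (A(j := {})) B'"
proof -
  note m = is_matroid_deletion[OF is_matroid_matroid_of[OF assms(1)]]
  have c: "card B = card B'" using card_basis[OF m B] card_basis[OF m B'] by simp
  have BE: "B \<subseteq> E - D" and BE': "B' \<subseteq> E - D" and PB': "partial_transversal r A B'"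
    using B B' unfolding basis_deletion_iff by auto
  have fin: "finite B" "finite B'" using BE BE' assms(1) by (meson finite_Diff finite_subset)+
  obtain Y d where Y: "B' \<subseteq> insert d Y" "Y \<subseteq> B'" "d \<in> A j \<or> B' = Y"
      "partial_transversal r (A(j := {})) Y"
    using partial_transversal_remove_one[OF PB', of j] by blast
  show ?thesis
  proof (cases "Y = B'")
    case True
    then show ?thesis using Y by simp
  next
    case False
    then have d: "d \<in> A j" "B' = insert d Y" using Y by auto
    have "card Y < card B" using False Y(2) fin(2) c by (metis psubsetI psubset_card_mono)
    then obtain b where b: "b \<in> B - Y" "partial_transversal r (A(j := {})) (insert b Y)"
      using partial_transversal_augment[OF finite_subset[OF Y(2) fin(2)] fin(1) _ Y(4) j] by blast
    show ?thesis
    proof (cases "b = d")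
      case True
      then show ?thesis using b d by simp
    next
      case False
      have "partial_transversal r A (insert d (insert b Y))"
        using b(2) assms(2) d(1) by (rule partial_transversal_insert_without)
      then have "partial_transversal r A (insert b B')" using d by (simp add: insert_commute)
      then have "insert b B' = B'"
        using b(1) BE BE' by (intro basis_deletion_maximal[OF B']) auto
      then show ?thesis using False b d by blast
    qed
  qed
qed

section \<open>Independence and coloops in the extensions\<close>

lemma partial_transversal_extend_system:
  assumes "x \<notin> X"
  shows "partial_transversal r (extend_system A x I) X \<longleftrightarrow> partial_transversal r A X"
proof -
  have "e \<in> extend_system A x I i \<longleftrightarrow> e \<in> A i" if "e \<in> X" for e i
    using that assms unfolding extend_system_def by auto
  then show ?thesis unfolding partial_transversal_def by auto
qed

lemma partial_transversal_extend_system_insert: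
  assumes "x \<notin> X" "\<forall>i\<in>{1..r}. x \<notin> A i"
  shows "partial_transversal r (extend_system A x I) (insert x X) \<longleftrightarrow>
    (\<exists>j\<in>I \<inter> {1..r}. partial_transversal r (A(j := {})) X)"
proof
  assume "partial_transversal r (extend_system A x I) (insert x X)"
  then obtain \<phi> where \<phi>: "inj_on \<phi> (insert x X)"
      "\<forall>e\<in>insert x X. \<phi> e \<in> {1..r} \<and> e \<in> extend_system A x I (\<phi> e)"
    unfolding partial_transversal_def by blast
  then have "\<phi> x \<in> I \<inter> {1..r}"
    using assms(2) unfolding extend_system_def by (auto split: if_splits)
  moreover have "partial_transversal r (A(\<phi> x := {})) X"
    unfolding partial_transversal_def
  proof (intro exI[of _ \<phi>] conjI ballI)
    show "inj_on \<phi> X" using \<phi>(1) by (rule inj_on_subset) auto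
    fix e assume e: "e \<in> X"
    then have "\<phi> e \<noteq> \<phi> x" using assms(1) \<phi>(1) unfolding inj_on_def by blast
    then show "\<phi> e \<in> {1..r}" "e \<in> (A(\<phi> x := {})) (\<phi> e)"
      using \<phi>(2) e assms(1) unfolding extend_system_def by (auto split: if_splits)
  qed
  ultimately show "\<exists>j\<in>I \<inter> {1..r}. partial_transversal r (A(j := {})) X" by blast
next
  assume "\<exists>j\<in>I \<inter> {1..r}. partial_transversal r (A(j := {})) X"
  then obtain j where j: "j \<in> I" "j \<in> {1..r}" "partial_transversal r (A(j := {})) X" by blast
  have "partial_transversal r ((extend_system A x I)(j := {})) X"
    using j(3) by (rule partial_transversal_mono) (auto simp: extend_system_def)
  then show "partial_transversal r (extend_system A x I) (insert x X)"
    using j(2) by (rule partial_transversal_insert_without) (use j(1) in \<open>simp add: extend_system_def\<close>)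
qed

lemma coloop_extension_iff:
  assumes A: "set_system E r A" and x: "x \<notin> E" and k: "k \<in> {1..r}"
    and B: "basis (deletion (matroid_of E r A) (A k)) B"
  shows "coloop (deletion (extension_matroid E r A x I) (A k)) x \<longleftrightarrow>
    (\<exists>j\<in>I \<inter> {1..r}. partial_transversal r (A(j := {})) B)"
proof -
  let ?D = "deletion (extension_matroid E r A x I) (A k)"
  have xA: "\<forall>i\<in>{1..r}. x \<notin> A i" and finE: "finite E"
    using A x unfolding set_system_def by auto
  note ins = partial_transversal_extend_system_insert[OF _ xA]
  have maximal: "C' = C"
    if "basis ?D C" "C' \<subseteq> insert x E - A k" "partial_transversal r (extend_system A x I) C'"
      "C \<subseteq> C'" for C C'
    using basis_deletion_maximal[of "E \<union> {x}"] that unfolding extension_matroid_def by simp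
  have basis_iff: "basis ?D C \<longleftrightarrow> C \<subseteq> insert x E - A k \<and>
      partial_transversal r (extend_system A x I) C \<and>
      (\<forall>C'. C' \<subseteq> insert x E - A k \<and> partial_transversal r (extend_system A x I) C' \<and>
        C \<subseteq> C' \<longrightarrow> C' = C)" for C
    unfolding extension_matroid_def basis_deletion_iff by simp
  have xD: "x \<in> insert x E - A k" using xA k by auto
  show ?thesis
  proof
    assume co: "coloop ?D x"
    have BE: "B \<subseteq> E - A k" "partial_transversal r A B" using B unfolding basis_deletion_iff by auto
    then have "x \<notin> B" using x by blast
    \<comment> \<open>Hence \<open>B\<close> grows in the extension, and by its maximality in the
      original matroid only \<open>x\<close> allows this.\<close>
    then have "\<not> basis ?D B" using co unfolding coloop_def by blast
    then obtain C where C: "C \<subseteq> insert x E - A k" "partial_transversal r (extend_system A x I) C"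
        "B \<subseteq> C" "C \<noteq> B"
      using BE partial_transversal_extend_system[OF \<open>x \<notin> B\<close>] unfolding basis_iff by blast
    have "x \<in> C"
    proof (rule ccontr)
      assume "x \<notin> C"
      then have "C \<subseteq> E - A k" "partial_transversal r A C"
        using C(1,2) partial_transversal_extend_system[of x C] by auto
      then show False using basis_deletion_maximal[OF B] C(3,4) by blast
    qed
    then have "partial_transversal r (extend_system A x I) (insert x B)"
      using C(2,3) by (auto elim!: partial_transversal_subset)
    then show "\<exists>j\<in>I \<inter> {1..r}. partial_transversal r (A(j := {})) B"
      using ins[OF \<open>x \<notin> B\<close>] by blast
  next
    assume "\<exists>j\<in>I \<inter> {1..r}. partial_transversal r (A(j := {})) B"
    then obtain j where j: "j \<in> I" "j \<in> {1..r}" "partial_transversal r (A(j := {})) B" by blast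
    show "coloop ?D x" unfolding coloop_def
    proof (intro conjI allI impI)
      show "x \<in> ground ?D" using xD by (simp add: deletion_def extension_matroid_def matroid_of_def)
      fix C assume C: "basis ?D C"
      show "x \<in> C"
      proof (rule ccontr)
        assume xC: "x \<notin> C"
        have "basis (deletion (matroid_of E r A) (A k)) C"
          unfolding basis_deletion_iff
        proof (intro conjI allI impI)
          show "C \<subseteq> E - A k" "partial_transversal r A C"
            using C xC partial_transversal_extend_system[OF xC] unfolding basis_iff by auto
          fix C' assume C': "C' \<subseteq> E - A k \<and> partial_transversal r A C' \<and> C \<subseteq> C'"
          then have "x \<notin> C'" using x by blast
          then have "partial_transversal r (extend_system A x I) C'"
            using C' by (simp add: partial_transversal_extend_system)
          then show "C' = C" using C' by (intro maximal[OF C]) auto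
        qed
        from basis_deletion_avoid_cong[OF finE j(2) B this j(3)]
        have "partial_transversal r (extend_system A x I) (insert x C)"
          using j ins[OF xC] by blast
        moreover have "C \<subseteq> insert x E - A k" using C unfolding basis_iff by simp
        ultimately have "insert x C = C" using xD by (intro maximal[OF C]) auto
        then show False using xC by blast
      qed
    qed
  qed
qed

section \<open>The operator \<open>sigma_op\<close> and equality of extensions\<close>

text \<open>A set is fixed iff no outside index \<open>k\<close> passes the coloop test. Any choice
  of bases decides these tests, which leaves a condition on pairs \<open>(k, j)\<close>
  alone.\<close>

lemma L_sets_eq:
  assumes "set_system E r A" "x \<notin> E"
    and "\<And>k. k \<in> {1..r} \<Longrightarrow> basis (deletion (matroid_of E r A) (A k)) (B k)"
  shows "L_sets E r A x = {I. I \<subseteq> {1..r} \<and>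
    (\<forall>k\<in>{1..r} - I. \<forall>j\<in>I. \<not> partial_transversal r (A(j := {})) (B k))}"
proof -
  have "sigma_op E r A x I = I \<longleftrightarrow>
      (\<forall>k\<in>{1..r} - I. \<forall>j\<in>I. \<not> partial_transversal r (A(j := {})) (B k))"
    if I: "I \<subseteq> {1..r}" for I
  proof -
    have "coloop (deletion (extension_matroid E r A x I) (A k)) x \<longleftrightarrow>
        (\<exists>j\<in>I. partial_transversal r (A(j := {})) (B k))" if "k \<in> {1..r} - I" for k
    proof -
      have "k \<in> {1..r}" using that by blast
      from coloop_extension_iff[OF assms(1,2) this assms(3)[OF this], of I] show ?thesis
        using I by (simp add: Int_absorb2)
    qed
    then show ?thesis unfolding sigma_op_def by blast
  qed
  then show ?thesis unfolding L_sets_def by (intro Collect_cong conj_cong refl)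
qed

lemma sigma_op_eq:
  assumes A: "set_system E r A" and x: "x \<notin> E" and I: "I \<subseteq> {1..r}"
  shows "sigma_op E r A x I = {k\<in>{1..r}. \<forall>X\<subseteq>E. partial_transversal r (A(k := {})) X \<longrightarrow>
    (\<exists>j\<in>I. partial_transversal r (A(j := {})) X)}"
proof -
  have finE: "finite E" using A unfolding set_system_def by blast
  have "coloop (deletion (extension_matroid E r A x I) (A k)) x \<longleftrightarrow>
      (\<forall>X\<subseteq>E. partial_transversal r (A(k := {})) X \<longrightarrow>
        (\<exists>j\<in>I. partial_transversal r (A(j := {})) X))" if k: "k \<in> {1..r}" for k
  proof -
    let ?D = "deletion (matroid_of E r A) (A k)"
    have m: "is_matroid ?D" by (intro is_matroid_deletion is_matroid_matroid_of finE)
    have Int_I: "I \<inter> {1..r} = I" using I by blast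
    note co = coloop_extension_iff[OF A x k, of _ I, unfolded Int_I]
    show ?thesis
    proof (intro iffI allI impI)
      fix X assume c: "coloop (deletion (extension_matroid E r A x I) (A k)) x"
        and X: "X \<subseteq> E" "partial_transversal r (A(k := {})) X"
      have "partial_transversal r A X" using X(2) by (rule partial_transversal_mono) auto
      \<comment> \<open>The deletion sees only the part of \<open>X\<close> outside
        \<open>A k\<close>; the exchange lemma restores the rest at the end.\<close>
      then have "X - A k \<in> indep_sets ?D"
        using X(1) by (auto simp: deletion_def matroid_of_def elim!: partial_transversal_subset)
      then obtain B where B: "basis ?D B" "X - A k \<subseteq> B" using indep_subset_basis[OF m] by blast
      then obtain j where "j \<in> I" "partial_transversal r (A(j := {})) B" using co c by blast
      moreover from this(2) have "partial_transversal r (A(j := {})) (X - A k)"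
        using B(2) by (rule partial_transversal_subset)
      ultimately show "\<exists>j\<in>I. partial_transversal r (A(j := {})) X"
        using partial_transversal_avoid_exchange[OF finite_subset[OF X(1) finE] X(2) k] by blast
    next
      assume all: "\<forall>X\<subseteq>E. partial_transversal r (A(k := {})) X \<longrightarrow>
        (\<exists>j\<in>I. partial_transversal r (A(j := {})) X)"
      obtain B where B: "basis ?D B" using indep_subset_basis[OF m is_matroidD(3)[OF m]] by blast
      then have "B \<subseteq> E - A k" "partial_transversal r A B" unfolding basis_deletion_iff by auto
      then have "B \<subseteq> E" "partial_transversal r (A(k := {})) B"
        using partial_transversal_without[of r A B k] by auto
      then show "coloop (deletion (extension_matroid E r A x I) (A k)) x"
        using all co[OF B] by blast
    qed
  qed
  \<comment> \<open>An index \<open>k\<close> in \<open>I\<close> satisfies the right-hand condition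
    with \<open>j = k\<close>.\<close>
  then show ?thesis using I unfolding sigma_op_def by blast
qed

text \<open>Sets without \<open>x\<close> have the same status in every extension, so two extensions
  can differ only on sets \<open>insert x X\<close>.\<close>

lemma extension_matroid_eq_iff:
  assumes A: "set_system E r A" and x: "x \<notin> E" and I: "I \<subseteq> {1..r}" "J \<subseteq> {1..r}"
  shows "extension_matroid E r A x I = extension_matroid E r A x J \<longleftrightarrow>
    (\<forall>X\<subseteq>E. (\<exists>j\<in>I. partial_transversal r (A(j := {})) X) \<longleftrightarrow>
      (\<exists>j\<in>J. partial_transversal r (A(j := {})) X))"
proof -
  have xA: "\<forall>i\<in>{1..r}. x \<notin> A i" using A x unfolding set_system_def by auto
  have ins: "partial_transversal r (extend_system A x I) (insert x X) \<longleftrightarrow>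
      (\<exists>j\<in>I. partial_transversal r (A(j := {})) X)" if "X \<subseteq> E" "I \<subseteq> {1..r}" for X I
  proof -
    have "x \<notin> X" "I \<inter> {1..r} = I" using that x by auto
    then show ?thesis using partial_transversal_extend_system_insert[of x X r A I] xA by simp
  qed
  have "extension_matroid E r A x I = extension_matroid E r A x J \<longleftrightarrow>
      (\<forall>X\<subseteq>insert x E. partial_transversal r (extend_system A x I) X \<longleftrightarrow>
        partial_transversal r (extend_system A x J) X)"
    unfolding extension_matroid_def matroid_of_def by auto
  also have "\<dots> \<longleftrightarrow> (\<forall>X\<subseteq>E. partial_transversal r (extend_system A x I) (insert x X) \<longleftrightarrow>
        partial_transversal r (extend_system A x J) (insert x X))"
  proof (rule iffI; intro allI impI)
    fix X
    assume *: "\<forall>X\<subseteq>E. partial_transversal r (extend_system A x I) (insert x X) \<longleftrightarrow>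
        partial_transversal r (extend_system A x J) (insert x X)" and X: "X \<subseteq> insert x E"
    show "partial_transversal r (extend_system A x I) X \<longleftrightarrow>
        partial_transversal r (extend_system A x J) X"
    proof (cases "x \<in> X")
      case True
      then have "insert x (X - {x}) = X" "X - {x} \<subseteq> E" using X by auto
      then show ?thesis using * by metis
    next
      case False
      then show ?thesis by (simp add: partial_transversal_extend_system)
    qed
  qed blast
  finally show ?thesis using ins I by auto
qed

text \<open>The sets \<open>I\<close> and \<open>sigma_op E r A x I\<close> give the same extension,
  and the extension determines \<open>sigma_op E r A x I\<close>. So every extension comes from
  exactly one fixed set.\<close>

lemma card_T_exts_eq_card_L_sets:
  assumes A: "set_system E r A" and x: "x \<notin> E"
  shows "card (T_exts E r A x) = card (L_sets E r A x)"
proof -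
  let ?e = "extension_matroid E r A x" and ?s = "sigma_op E r A x"
  note sig = sigma_op_eq[OF A x] and ext = extension_matroid_eq_iff[OF A x]
  have sub: "?s I \<subseteq> {1..r}" if "I \<subseteq> {1..r}" for I using sig[OF that] by auto
  have sigma_cong: "?s I = ?s J" if "?e I = ?e J" "I \<subseteq> {1..r}" "J \<subseteq> {1..r}" for I J
    using that ext[of I J] sig[of I] sig[of J] by auto
  have e_sigma: "?e (?s I) = ?e I" if I: "I \<subseteq> {1..r}" for I
  proof -
    have "I \<subseteq> ?s I" unfolding sigma_op_def by blast
    then show ?thesis unfolding ext[OF sub[OF I] I] using sig[OF I] by blast
  qed
  have "T_exts E r A x = ?e ` L_sets E r A x"
  proof
    show "T_exts E r A x \<subseteq> ?e ` L_sets E r A x"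
    proof
      fix N assume "N \<in> T_exts E r A x"
      then obtain I where I: "I \<subseteq> {1..r}" "N = ?e I" unfolding T_exts_def by blast
      have "?s (?s I) = ?s I" using sigma_cong[OF e_sigma[OF I(1)] sub[OF I(1)] I(1)] .
      then have "?s I \<in> L_sets E r A x" using sub[OF I(1)] unfolding L_sets_def by blast
      then show "N \<in> ?e ` L_sets E r A x" using e_sigma[OF I(1)] I(2) by (metis imageI)
    qed
  qed (auto simp: T_exts_def L_sets_def)
  moreover have "inj_on ?e (L_sets E r A x)"
    by (rule inj_onI) (metis (mono_tags, lifting) L_sets_def mem_Collect_eq sigma_cong)
  ultimately show ?thesis by (simp add: card_image)
qed

section \<open>The upper bound\<close>

lemma card_avoidable_indices_ge:
  assumes "partial_transversal r A X"
  shows "r - card X \<le> card {j\<in>{1..r}. partial_transversal r (A(j := {})) X}"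
proof -
  obtain \<phi> where \<phi>: "inj_on \<phi> X" "\<forall>e\<in>X. \<phi> e \<in> {1..r} \<and> e \<in> A (\<phi> e)"
    using assms unfolding partial_transversal_def by blast
  have "\<phi> ` X \<subseteq> {1..r}" using \<phi>(2) by blast
  then have "card ({1..r} - \<phi> ` X) = r - card X"
    using \<phi>(1) by (simp add: card_Diff_subset card_image finite_subset)
  moreover have "{1..r} - \<phi> ` X \<subseteq> {j\<in>{1..r}. partial_transversal r (A(j := {})) X}"
  proof
    fix j assume j: "j \<in> {1..r} - \<phi> ` X"
    then have "partial_transversal r (A(j := {})) X"
      using \<phi> unfolding partial_transversal_def by (intro exI[of _ \<phi>]) auto
    then show "j \<in> {j\<in>{1..r}. partial_transversal r (A(j := {})) X}" using j by blast
  qed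
  then have "card ({1..r} - \<phi> ` X) \<le> card {j\<in>{1..r}. partial_transversal r (A(j := {})) X}"
    by (intro card_mono) auto
  ultimately show ?thesis by simp
qed

lemma card_L_sets_le:
  assumes pres: "presentation M A" and r: "matroid_rank M = r"
    and i: "presentation_rank M A = int i" and x: "x \<notin> ground M"
  shows "real (card (L_sets (ground M) r A x)) \<le> (1 / 2 + 1 / 2 ^ (i + 1)) * 2 ^ r"
proof -
  let ?E = "ground M" and ?S = "{1..r}"
  note pres' = pres[unfolded presentation_def r]
  note A = conjunct1[OF pres'] and M = conjunct2[OF pres', symmetric]
  have m: "is_matroid (deletion M D)" for D
    using is_matroid_deletion[OF is_matroid_presentation[OF pres]] .
  have "\<exists>B. basis (deletion M (A k)) B" for k
    using indep_subset_basis[OF m is_matroidD(3)[OF m]] by blast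
  then obtain B where B: "\<And>k. basis (deletion M (A k)) (B k)" by metis
  define U where "U k = {j\<in>?S. partial_transversal r (A(j := {})) (B k)}" for k
  \<comment> \<open>Taking \<open>k\<close> out of \<open>U k\<close> makes \<open>R\<close>
    irreflexive; it costs one index for each \<open>k\<close>, which the \<open>- 1\<close> in
    \<open>cU\<close> records.\<close>
  define R where "R = (SIGMA k:?S. U k - {k})"
  let ?C = "{V. V \<subseteq> ?S \<and> (\<forall>(v, w)\<in>R. v \<in> V \<longrightarrow> w \<in> V)}"
  have BM: "basis (deletion (matroid_of ?E r A) (A k)) (B k)" for k using B by (simp only: M)
  have BP: "partial_transversal r A (B k)" "B k \<inter> A k = {}" for k
    using BM[of k] unfolding basis_deletion_iff by auto
  have kU: "k \<in> U k" if "k \<in> ?S" for k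
    using that partial_transversal_without[OF BP] unfolding U_def by blast
  have finU: "finite (U k)" for k unfolding U_def by simp
  have cU: "int r - 1 - int (matroid_rank (deletion M (A k))) \<le> int (card (U k - {k}))"
    if k: "k \<in> ?S" for k
  proof -
    have "r - card (B k) \<le> card (U k)"
      using card_avoidable_indices_ge[OF BP(1)] unfolding U_def .
    moreover have "card (B k) = matroid_rank (deletion M (A k))" using card_basis[OF m B] .
    moreover have "card (U k) = Suc (card (U k - {k}))" using kU[OF k] finU by (metis card.remove)
    ultimately show ?thesis by linarith
  qed
  \<comment> \<open>The term \<open>r * (r - 1)\<close> of the rank is spread over the
    \<open>r\<close> indices.\<close>
  have "int i = (\<Sum>k\<in>?S. int r - 1 - int (matroid_rank (deletion M (A k))))"
    using i unfolding presentation_rank_def r by (simp add: sum_subtractf right_diff_distrib)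
  also have "\<dots> \<le> (\<Sum>k\<in>?S. int (card (U k - {k})))" using cU by (rule sum_mono)
  also have "\<dots> = int (card R)" unfolding R_def using finU by (subst card_SigmaI) auto
  finally have iR: "i \<le> card R" by simp
  have "L_sets ?E r A x = {I. I \<subseteq> ?S \<and> (\<forall>k\<in>?S - I. \<forall>j\<in>I. \<not> partial_transversal r (A(j := {})) (B k))}"
    by (rule L_sets_eq[OF A x BM])
  \<comment> \<open>If \<open>k\<close> is outside \<open>I\<close> and \<open>j\<close> is in
    \<open>U k\<close>, then \<open>j\<close> is outside \<open>I\<close>.\<close>
  then have "(\<lambda>I. ?S - I) ` L_sets ?E r A x \<subseteq> ?C"
    unfolding R_def U_def by auto
  moreover have "inj_on (\<lambda>I. ?S - I) (L_sets ?E r A x)"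
    unfolding L_sets_def inj_on_def by blast
  ultimately have "card (L_sets ?E r A x) \<le> card ?C"
    by (intro card_inj_on_le[of "\<lambda>I. ?S - I"]) auto
  then have "real (card (L_sets ?E r A x)) \<le> real (card ?C)" unfolding of_nat_le_iff .
  moreover have "R \<subseteq> ?S \<times> ?S" "\<And>k. (k, k) \<notin> R" unfolding R_def U_def by auto
  then have "real (card ?C) \<le> (1 / 2 + 1 / 2 ^ (card R + 1)) * 2 ^ r"
    using card_relation_closed_le[of ?S R] by simp
  moreover have "(1 / 2 + 1 / 2 ^ (card R + 1)) * 2 ^ r \<le> (1 / 2 + 1 / 2 ^ (i + 1)) * (2 ^ r :: real)"
    using iR by (intro mult_right_mono add_left_mono divide_left_mono power_increasing) auto
  ultimately show ?thesis by linarith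
qed

section \<open>Sharpness\<close>

lemma matroid_rank_free: "finite F \<Longrightarrow> matroid_rank (F, Pow F) = card F"
  unfolding matroid_rank_def by (intro Max_eqI) (auto intro: card_mono)

lemma card_L_sets_sharp:
  fixes r i :: nat
  assumes "1 \<le> i" "i < r"
  defines "M \<equiv> ({1..r}, Pow {1..r})" and "A \<equiv> (\<lambda>k. if k = 1 then {1..Suc i} else {k})"
  shows "matroid_rank M = r" "presentation M A" "presentation_rank M A = int i"
    "\<And>x. x \<notin> ground M \<Longrightarrow>
      real (card (L_sets (ground M) r A x)) = (1 / 2 + 1 / 2 ^ (i + 1)) * 2 ^ r"
proof -
  let ?S = "{1..r}"
  have g: "ground M = ?S" by (simp add: M_def)
  show rM: "matroid_rank M = r" unfolding M_def by (simp add: matroid_rank_free)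
  have A: "set_system ?S r A" using assms(2) by (auto simp: set_system_def A_def)
  \<comment> \<open>Each \<open>k\<close> lies in \<open>A k\<close>, so the identity is a
    matching.\<close>
  have PT: "partial_transversal r A X" if "X \<subseteq> ?S" for X
    unfolding partial_transversal_def
    by (intro exI[of _ id]) (use that in \<open>auto simp: A_def\<close>)
  show P: "presentation M A"
    by (rule presentationI) (use A PT rM in \<open>auto simp: M_def\<close>)
  have M: "matroid_of ?S r A = M" using P g rM unfolding presentation_def by metis
  have "deletion M (A k) = (?S - A k, Pow (?S - A k))" for k
    unfolding deletion_def M_def by auto
  then have rk: "matroid_rank (deletion M (A k)) = card (?S - A k)" for k
    by (simp add: matroid_rank_free)
  have c1: "card (?S - A 1) = r - Suc i"
    using assms(1,2) by (simp add: A_def card_Diff_subset)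
  have ck: "card (?S - A k) = r - 1" if "k \<in> ?S - {1}" for k
    using that by (simp add: A_def)
  have "(\<Sum>k\<in>?S. int (card (?S - A k))) =
      int (card (?S - A 1)) + (\<Sum>k\<in>?S - {1}. int (card (?S - A k)))"
    using assms(2) by (intro sum.remove) auto
  also have "\<dots> = int (r - Suc i) + int (r - 1) * int (r - 1)"
    using ck c1 card_Diff_singleton[of 1 ?S] assms(2) by simp
  also have "\<dots> = int r * (int r - 1) - int i"
    using assms(1,2) by (simp add: of_nat_diff algebra_simps)
  finally show rank: "presentation_rank M A = int i"
    unfolding presentation_rank_def rM rk by simp
  fix x assume x: "x \<notin> ground M"
  have B: "basis (deletion (matroid_of ?S r A) (A k)) (?S - A k)" for k
    using PT[of "?S - A k"] unfolding basis_deletion_iff by blast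
  have L: "L_sets ?S r A x = {I. I \<subseteq> ?S \<and>
      (\<forall>k\<in>?S - I. \<forall>j\<in>I. \<not> partial_transversal r (A(j := {})) (?S - A k))}"
    using x g by (intro L_sets_eq[OF A _ B]) auto
  \<comment> \<open>Either \<open>1\<close> is in \<open>I\<close>, or \<open>I\<close> avoids all
    of \<open>{1..Suc i}\<close>.\<close>
  let ?X = "{I. {1} \<subseteq> I \<and> I \<subseteq> ?S}" and ?Y = "Pow {Suc (Suc i)..r}"
  have "?X \<union> ?Y \<subseteq> L_sets ?S r A x"
  proof
    fix I assume I: "I \<in> ?X \<union> ?Y"
    then have IS: "I \<subseteq> ?S" by auto
    have "\<not> partial_transversal r (A(j := {})) (?S - A k)" if k: "k \<in> ?S - I" and j: "j \<in> I" for k j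
    proof
      assume "partial_transversal r (A(j := {})) (?S - A k)"
      then obtain \<phi> where \<phi>: "inj_on \<phi> (?S - A k)"
          "\<forall>e\<in>?S - A k. \<phi> e \<in> ?S \<and> e \<in> (A(j := {})) (\<phi> e)"
        unfolding partial_transversal_def by blast
      then have nj: "\<phi> e \<noteq> j" "e \<in> A (\<phi> e)" if "e \<in> ?S - A k" for e
        using that by (auto split: if_splits)
      show False
      proof (cases "k = 1")
        case True
        then have "I \<in> ?Y" using k I by auto
        \<comment> \<open>Outside \<open>A 1\<close> the element \<open>j\<close> belongs to
          \<open>A j\<close> only, and that set has been emptied.\<close>
        then have "j \<in> ?S - A k" "j \<notin> A 1" using j True by (auto simp: A_def)
        then show False using nj[of j] by (auto simp: A_def split: if_splits)
      next
        case False
        have j': "j \<in> ?S - A k" using False j k IS by (auto simp: A_def)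
        have 1: "1 \<in> ?S - A k" using False assms(2) by (auto simp: A_def)
        \<comment> \<open>The element \<open>1\<close> lies in \<open>A 1\<close> only and occupies
          index \<open>1\<close>, so \<open>j\<close> could only be matched to the forbidden index
          \<open>j\<close>.\<close>
        then have \<phi>1: "\<phi> 1 = 1" using nj(2)[OF 1] by (auto simp: A_def split: if_splits)
        have "j \<noteq> 1" using nj(1)[OF 1] \<phi>1 by auto
        then have "\<phi> j \<noteq> 1" using \<phi>(1) 1 j' \<phi>1 unfolding inj_on_def by metis
        then show False using nj[OF j'] by (auto simp: A_def split: if_splits)
      qed
    qed
    then show "I \<in> L_sets ?S r A x" unfolding L using IS by blast
  qed
  moreover have "finite (L_sets ?S r A x)" unfolding L_sets_def by simp
  ultimately have "card (?X \<union> ?Y) \<le> card (L_sets ?S r A x)" by (intro card_mono)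
  moreover have "card (?X \<union> ?Y) = card ?X + card ?Y"
    by (intro card_Un_disjoint) auto
  moreover have "card ?X = 2 ^ (r - 1)"
    using card_subsets_above[of ?S "{1}"] assms(2) by simp
  moreover have "card ?Y = 2 ^ (r - 1 - i)" by (simp add: card_Pow)
  ultimately have "2 ^ (r - 1) + 2 ^ (r - 1 - i) \<le> card (L_sets ?S r A x)" by simp
  from of_nat_mono[OF this, where 'a = real]
  have "(2::real) ^ (r - 1) + 2 ^ (r - 1 - i) \<le> real (card (L_sets ?S r A x))" by simp
  moreover have "(2::real) ^ (r - 1) + 2 ^ (r - 1 - i) = (1 / 2 + 1 / 2 ^ (i + 1)) * 2 ^ r"
    using assms(1,2) by (cases r) (auto simp: power_diff algebra_simps)
  moreover have "real (card (L_sets ?S r A x)) \<le> (1 / 2 + 1 / 2 ^ (i + 1)) * 2 ^ r"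
    using card_L_sets_le[OF P rM rank x] g by simp
  ultimately show "real (card (L_sets (ground M) r A x)) = (1 / 2 + 1 / 2 ^ (i + 1)) * 2 ^ r"
    unfolding g by linarith
qed

section \<open>Assembling both ranges of \<open>i\<close> and the example\<close>

theorem theorem4p1:
  shows "(\<forall>(M :: 'a matroid) (A :: nat \<Rightarrow> 'a set) (x :: 'a) (r :: nat) (i :: nat).
            transversal_matroid M \<and> matroid_rank M = r \<and>
            presentation M A \<and> presentation_rank M A = int i \<and> x \<notin> ground M \<longrightarrow>
              (1 \<le> i \<and> i < r \<longrightarrow>
                 card (T_exts (ground M) r A x) = card (L_sets (ground M) r A x) \<and>
                 real (card (L_sets (ground M) r A x)) \<le> (1 / 2 + 1 / 2 ^ (i + 1)) * 2 ^ r) \<and>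
              (r \<le> i \<longrightarrow>
                 card (T_exts (ground M) r A x) = card (L_sets (ground M) r A x) \<and>
                 card (L_sets (ground M) r A x) \<le> 2 ^ (r - 1)))
       \<and> (\<forall>(r :: nat) (i :: nat). 1 \<le> i \<and> i < r \<longrightarrow>
            (\<exists>(M :: nat matroid) (A :: nat \<Rightarrow> nat set).
               transversal_matroid M \<and> matroid_rank M = r \<and>
               presentation M A \<and> presentation_rank M A = int i \<and>
               (\<forall>x. x \<notin> ground M \<longrightarrow>
                  card (T_exts (ground M) r A x) = card (L_sets (ground M) r A x) \<and>
                  real (card (L_sets (ground M) r A x)) = (1 / 2 + 1 / 2 ^ (i + 1)) * 2 ^ r)))"
proof (intro conjI allI impI)
  fix M :: "'a matroid" and A :: "nat \<Rightarrow> 'a set" and x :: 'a and r i :: nat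
  assume *: "transversal_matroid M \<and> matroid_rank M = r \<and>
    presentation M A \<and> presentation_rank M A = int i \<and> x \<notin> ground M"
  then have P: "presentation M A" and r: "matroid_rank M = r"
    and i: "presentation_rank M A = int i" and x: "x \<notin> ground M" by blast+
  have A: "set_system (ground M) r A" using P r unfolding presentation_def by blast
  show "card (T_exts (ground M) r A x) = card (L_sets (ground M) r A x)"
    and "card (T_exts (ground M) r A x) = card (L_sets (ground M) r A x)"
    using card_T_exts_eq_card_L_sets[OF A x] by blast+
  note le = card_L_sets_le[OF P r i x]
  then show "real (card (L_sets (ground M) r A x)) \<le> (1 / 2 + 1 / 2 ^ (i + 1)) * 2 ^ r" .
  assume ri: "r \<le> i"
  show "card (L_sets (ground M) r A x) \<le> 2 ^ (r - 1)"
  proof (cases r)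
    case 0
    \<comment> \<open>Here \<open>r - 1\<close> is truncated to \<open>0\<close>, so the bound is
      \<open>1\<close>.\<close>
    then have "L_sets (ground M) r A x \<subseteq> {{}}" unfolding L_sets_def by auto
    then show ?thesis using card_mono[of "{{}}" "L_sets (ground M) r A x"] 0 by simp
  next
    case (Suc n)
    \<comment> \<open>For \<open>r \<le> i\<close> the excess of the general bound over
      \<open>2 ^ n\<close> is less than \<open>1\<close>, so it vanishes for integers.\<close>
    have "(2::real) ^ n < 2 ^ i" using Suc ri by (intro power_strict_increasing) auto
    then have "(2::real) ^ n / 2 ^ i < 1" by simp
    moreover have "(1 / 2 + 1 / 2 ^ (i + 1)) * 2 ^ r = (2::real) ^ n + 2 ^ n / 2 ^ i"
      unfolding Suc by (simp add: algebra_simps)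
    moreover have "real (2 ^ n + 1) = 2 ^ n + 1" by simp
    ultimately have "real (card (L_sets (ground M) r A x)) < real (2 ^ n + 1)"
      using le by linarith
    then have "card (L_sets (ground M) r A x) < 2 ^ n + 1" unfolding of_nat_less_iff .
    then show ?thesis using Suc by simp
  qed
next
  fix r i :: nat
  assume ri: "1 \<le> i \<and> i < r"
  define M :: "nat matroid" where "M = ({1..r}, Pow {1..r})"
  define A :: "nat \<Rightarrow> nat set" where "A = (\<lambda>k. if k = 1 then {1..Suc i} else {k})"
  note sharp = card_L_sets_sharp[of i r, folded M_def A_def]
  have P: "presentation M A" and r: "matroid_rank M = r" using sharp ri by blast+
  have A: "set_system (ground M) r A" using P r unfolding presentation_def by blast
  have "transversal_matroid M"
    using P unfolding presentation_def transversal_matroid_def by blast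
  then show "\<exists>(M :: nat matroid) (A :: nat \<Rightarrow> nat set).
      transversal_matroid M \<and> matroid_rank M = r \<and>
      presentation M A \<and> presentation_rank M A = int i \<and>
      (\<forall>x. x \<notin> ground M \<longrightarrow>
        card (T_exts (ground M) r A x) = card (L_sets (ground M) r A x) \<and>
        real (card (L_sets (ground M) r A x)) = (1 / 2 + 1 / 2 ^ (i + 1)) * 2 ^ r)"
    using sharp ri card_T_exts_eq_card_L_sets[OF A] by (intro exI[of _ M] exI[of _ A]) simp
qed

end
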